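(* Let $r,k$ be positive integers, and let $\mathbb K$ be a field, of characteristic zero or at least $5$, which either has more than $2r$ elements or is a finite field of characteristic at least $2r$. If $2r=3k-1$, then there exist $n$ and a tensor $T=\sum_{i=1}^r a_i\wedge b_i\wedge c_i\in\Lambda^3(\mathbb K^n)$ with all terms $a_i\wedge b_i\wedge c_i$ nonzero, for which the Kruskal rank of the collection of subspaces $U_i=\langle a_i,b_i,c_i\rangle$, $i=1,\dots,r$, is at least $k$, and such that this is not the unique skew rank decomposition of $T$.
   Context: For a multiset $\{U_1,\dots,U_r\}$ of $r\ge1$ nonzero subspaces of $\mathbb K^n$, the Kruskal rank is the largest $\ell$ such that every sub-multiset of cardinality $\ell$ is in direct sum, i.e. $\dim(U_{i_1}+\dots+U_{i_\ell})=\dim U_{i_1}+\dots+\dim U_{i_\ell}$ for all pairwise distinct $i_1,\dots,i_\ell$. Here $x_1\wedge x_2\wedge x_3=\frac1{3!}\sum_{\sigma\in\mathfrak S_3}\operatorname{sgn}(\sigma)\,x_{\sigma(1)}\otimes x_{\sigma(2)}\otimes x_{\sigma(3)}$. The skew rank of $T\in\Lambda^3(\mathbb K^n)$ is the smallest number of terms in an expression of $T$ as a sum of wedge products $a\wedge b\wedge c$ with $a,b,c\in\mathbb K^n$; an expression with that minimal number of terms is a skew rank decomposition. A given $r$-term expression is the unique skew rank decomposition of $T$ if $T$ has skew rank $r$ and every $r$-term expression of $T$ as a sum of wedge products has the same terms (as elements of $\Lambda^3(\mathbb K^n)$) up to reordering.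
   Formalization: The case k = 1 (so r = 1) is excluded: there T is a single nonzero wedge product, which has skew rank 1 and is always its own unique skew rank decomposition, so the claim is false in that case. *)

theory Defs
  imports Complex_Main "HOL-Library.Function_Algebras" "HOL-Combinatorics.Permutations"
begin

(* Vectors are functions nat => 'a and order-three tensors are functions
   nat * nat * nat => 'a; addition is pointwise (Function_Algebras) and scalars act
   pointwise, so that one vector space structure on 'i => 'a serves for both. *)

definition fscale :: "'a::field \<Rightarrow> ('i \<Rightarrow> 'a) \<Rightarrow> ('i \<Rightarrow> 'a)" where
  "fscale c f = (\<lambda>i. c * f i)"

global_interpretation fsp: vector_space "fscale :: 'a::field \<Rightarrow> ('i \<Rightarrow> 'a) \<Rightarrow> ('i \<Rightarrow> 'a)"
  by unfold_locales (simp_all add: fscale_def fun_eq_iff algebra_simps)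

(* K^n, with coordinates indexed by 0, ..., n - 1. *)
definition Kn :: "nat \<Rightarrow> (nat \<Rightarrow> 'a::field) set" where
  "Kn n = {x. \<forall>i\<ge>n. x i = 0}"

definition tensor3 ::
  "(nat \<Rightarrow> 'a::field) \<Rightarrow> (nat \<Rightarrow> 'a) \<Rightarrow> (nat \<Rightarrow> 'a) \<Rightarrow> (nat \<times> nat \<times> nat \<Rightarrow> 'a)" where
  "tensor3 x y z = (\<lambda>(i, j, l). x i * y j * z l)"

(* The factor 1/3! is meaningful only when the characteristic is not 2 or 3. *)
definition wedge3 ::
  "(nat \<Rightarrow> 'a::field) \<Rightarrow> (nat \<Rightarrow> 'a) \<Rightarrow> (nat \<Rightarrow> 'a) \<Rightarrow> (nat \<times> nat \<times> nat \<Rightarrow> 'a)" where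
  "wedge3 x y z =
     fscale (1 / of_nat (fact 3))
       (\<Sum>\<sigma> | \<sigma> permutes {..<3::nat}.
          fscale (of_int (sign \<sigma>))
            (tensor3 ([x, y, z] ! \<sigma> 0) ([x, y, z] ! \<sigma> 1) ([x, y, z] ! \<sigma> 2)))"

definition Lambda3 :: "nat \<Rightarrow> (nat \<times> nat \<times> nat \<Rightarrow> 'a::field) set" where
  "Lambda3 n = fsp.span {wedge3 x y z | x y z. x \<in> Kn n \<and> y \<in> Kn n \<and> z \<in> Kn n}"

definition skew_expression ::
  "nat \<Rightarrow> nat \<Rightarrow> (nat \<Rightarrow> nat \<Rightarrow> 'a::field) \<Rightarrow> (nat \<Rightarrow> nat \<Rightarrow> 'a) \<Rightarrow> (nat \<Rightarrow> nat \<Rightarrow> 'a)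
     \<Rightarrow> (nat \<times> nat \<times> nat \<Rightarrow> 'a) \<Rightarrow> bool" where
  "skew_expression n r a b c T \<longleftrightarrow>
     (\<forall>i<r. a i \<in> Kn n \<and> b i \<in> Kn n \<and> c i \<in> Kn n) \<and>
     T = (\<Sum>i<r. wedge3 (a i) (b i) (c i))"

definition skew_rank :: "nat \<Rightarrow> (nat \<times> nat \<times> nat \<Rightarrow> 'a::field) \<Rightarrow> nat" where
  "skew_rank n T = (LEAST s. \<exists>a b c. skew_expression n s a b c T)"

(* Terms are compared as elements of Lambda^3, not through the vectors a i, b i, c i. *)
definition unique_skew_rank_decomposition ::
  "nat \<Rightarrow> nat \<Rightarrow> (nat \<Rightarrow> nat \<Rightarrow> 'a::field) \<Rightarrow> (nat \<Rightarrow> nat \<Rightarrow> 'a) \<Rightarrow> (nat \<Rightarrow> nat \<Rightarrow> 'a)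
     \<Rightarrow> (nat \<times> nat \<times> nat \<Rightarrow> 'a) \<Rightarrow> bool" where
  "unique_skew_rank_decomposition n r a b c T \<longleftrightarrow>
     skew_expression n r a b c T \<and> skew_rank n T = r \<and>
     (\<forall>a' b' c'. skew_expression n r a' b' c' T \<longrightarrow>
        (\<exists>\<pi>. \<pi> permutes {..<r} \<and>
           (\<forall>i<r. wedge3 (a' i) (b' i) (c' i) = wedge3 (a (\<pi> i)) (b (\<pi> i)) (c (\<pi> i)))))"

(* The sum of the subspaces U i, i in I, is the span of their union. *)
definition in_direct_sum :: "nat set \<Rightarrow> (nat \<Rightarrow> (nat \<Rightarrow> 'a::field) set) \<Rightarrow> bool" where
  "in_direct_sum I U \<longleftrightarrow> fsp.dim (fsp.span (\<Union>i\<in>I. U i)) = (\<Sum>i\<in>I. fsp.dim (U i))"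

(* The multiset {U_1, ..., U_r} is the family U 0, ..., U (r - 1), and its sub-multisets are
   the subfamilies indexed by subsets of {..<r}, so repeated subspaces count separately.  The
   bound l <= r excludes the sizes for which there are no sub-multisets at all. *)
definition kruskal_rank :: "nat \<Rightarrow> (nat \<Rightarrow> (nat \<Rightarrow> 'a::field) set) \<Rightarrow> nat" where
  "kruskal_rank r U =
     Max {l. l \<le> r \<and> (\<forall>I. I \<subseteq> {..<r} \<and> card I = l \<longrightarrow> in_direct_sum I U)}"

(* For one nonzero term the decomposition is always unique, whatever the ambient space:
   this is why the existence of non-unique decompositions can only be claimed for r > 1. *)
lemma unique_skew_rank_decomposition_single:
  assumes "skew_expression n 1 a b c T" "wedge3 (a 0) (b 0) (c 0) \<noteq> 0"
  shows "unique_skew_rank_decomposition n 1 a b c T"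
proof -
  have T: "T = wedge3 (a 0) (b 0) (c 0)"
    using assms(1) by (simp add: skew_expression_def)
  have "skew_rank n T = 1"
    unfolding skew_rank_def
  proof (rule Least_equality)
    show "\<exists>a b c. skew_expression n 1 a b c T" using assms(1) by blast
    fix s assume "\<exists>a b c. skew_expression n s a b c T"
    then have "s \<noteq> 0" using T assms(2) by (auto simp: skew_expression_def)
    then show "1 \<le> s" by simp
  qed
  moreover have "\<exists>\<pi>. \<pi> permutes {..<1::nat} \<and>
      (\<forall>i<1. wedge3 (a' i) (b' i) (c' i) = wedge3 (a (\<pi> i)) (b (\<pi> i)) (c (\<pi> i)))"
    if "skew_expression n 1 a' b' c' T" for a' b' c'
    using that T by (intro exI[of _ id]) (auto simp: skew_expression_def permutes_id)
  ultimately show ?thesis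
    using assms(1) unfolding unique_skew_rank_decomposition_def by blast
qed

end

theory Submission
  imports Defs "HOL-Computational_Algebra.Polynomial"
begin

text \<open>The construction splits a linear dependency in the manner of Derksen's proof that Kruskal's
  uniqueness bound is sharp. Let \<open>v(t) = (1, t, \<dots>, t^(k-1))\<close>, placed into three
  complementary blocks of \<open>K^(3k)\<close> as \<open>v_0(t), v_1(t), v_2(t)\<close>. The coordinates of
  \<open>v_0(t) \<and> v_1(t) \<and> v_2(t)\<close> are monomials in \<open>t\<close> of degree at most
  \<open>3(k - 1) = 2r - 2\<close>, so for \<open>2r\<close> distinct points the Lagrange weights
  \<open>1 / (\<Prod>q \<noteq> p. p - q)\<close> produce a vanishing weighted sum of \<open>2r\<close> such terms. Moving
  half of the terms to the other side gives two different \<open>r\<close>-term expressions of one tensor, and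
  any \<open>k\<close> of the subspaces involved are in direct sum by the Vandermonde determinant.\<close>

section \<open>Coordinates of wedge products\<close>

lemma sum_apply: "(\<Sum>i\<in>A. f i) x = (\<Sum>i\<in>A. f i x)"
  by (induction A rule: infinite_finite_induct) simp_all

lemma wedge3_apply:
  "wedge3 x y z (i, j, l) = (1 / 6) *
     (x i * y j * z l - x i * z j * y l - y i * x j * z l
      + y i * z j * x l + z i * x j * y l - z i * y j * x l)"
proof -
  \<comment> \<open>Nested insertions let \<open>sum_over_permutations_insert\<close> peel off one
    element at a time.\<close>
  have *: "{..<3::nat} = {2, 1, 0}" by auto
  show ?thesis
    unfolding wedge3_def *
    by (simp add: sum_over_permutations_insert fscale_def tensor3_def sign_compose
        permutation_swap_id sign_swap_id permutation_compose Transposition.transpose_def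
        numeral_2_eq_2 numeral_3_eq_3 algebra_simps)
qed

lemma wedge3_fscale: "wedge3 (fscale c x) y z = fscale c (wedge3 x y z)"
  by (auto simp: fun_eq_iff wedge3_apply fscale_def algebra_simps)

section \<open>Lagrange weights and Vandermonde systems\<close>

definition lagrange_weight :: "'a::field set \<Rightarrow> 'a \<Rightarrow> 'a" where
  "lagrange_weight P t = 1 / (\<Prod>q\<in>P - {t}. t - q)"

lemma lagrange_weight_nonzero: "finite P \<Longrightarrow> lagrange_weight P t \<noteq> 0"
  by (auto simp: lagrange_weight_def)

text \<open>Interpolate \<open>x ^ d\<close> at \<open>P\<close> and compare the coefficients of \<open>x ^ (card P - 1)\<close>.\<close>
lemma sum_lagrange_weight_power:
  fixes P :: "'a::field set"
  assumes "finite P" "d + 2 \<le> card P"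
  shows "(\<Sum>t\<in>P. lagrange_weight P t * t ^ d) = 0"
proof -
  define N where "N = card P - 1"
  \<comment> \<open>For \<open>t\<close> in \<open>P\<close>, scaling \<open>m t\<close> by its
    weight gives the Lagrange basis polynomial; as \<open>m t\<close> is monic, the weight is its
    leading coefficient.\<close>
  define m where "m t = (\<Prod>q\<in>P - {t}. [:- q, 1:])" for t
  \<comment> \<open>The interpolation error: its degree is at most \<open>N\<close>, yet it vanishes
    at \<open>N + 1\<close> points.\<close>
  define p where "p = (\<Sum>t\<in>P. smult (lagrange_weight P t * t ^ d) (m t)) - monom 1 d"
  have deg_m: "degree (m t) = N" if "t \<in> P" for t
    using that assms by (simp add: m_def N_def degree_prod_sum_eq)
  have coeff_m: "coeff (m t) N = 1" if "t \<in> P" for t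
  proof -
    have "lead_coeff (m t) = 1" by (simp add: m_def lead_coeff_prod)
    then show ?thesis using deg_m[OF that] by simp
  qed
  have poly_m: "poly (m t) s = (if s = t then \<Prod>q\<in>P - {t}. t - q else 0)"
    if "t \<in> P" "s \<in> P" for s t
    using that assms(1) by (auto simp: m_def poly_prod)
  have "poly p s = 0" if "s \<in> P" for s
  proof -
    have "lagrange_weight P t * t ^ d * poly (m t) s = (if s = t then t ^ d else 0)"
      if "t \<in> P" for t
      using poly_m[OF that \<open>s \<in> P\<close>] assms(1) by (simp add: lagrange_weight_def)
    then have "poly p s = (\<Sum>t\<in>P. if s = t then t ^ d else 0) - s ^ d"
      by (simp add: p_def poly_sum poly_monom)
    then show ?thesis using that assms(1) by simp
  qed
  then have sub: "P \<subseteq> {x. poly p x = 0}" by auto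
  have "degree p \<le> N"
    unfolding p_def using assms(2)
    by (intro degree_diff_le degree_sum_le assms(1))
      (auto simp: deg_m N_def intro: order.trans[OF degree_smult_le] order.trans[OF degree_monom_le])
  have "p = 0"
  proof (rule ccontr)
    assume "p \<noteq> 0"
    then have "card P \<le> degree p"
      using card_mono[OF poly_roots_finite sub] card_poly_roots_bound[of p] by linarith
    then show False using \<open>degree p \<le> N\<close> assms(2) by (simp add: N_def)
  qed
  then have "coeff p N = 0" by simp
  \<comment> \<open>So \<open>monom 1 d\<close> does not contribute to the coefficient at
    \<open>N\<close>, and only the weighted sum is left.\<close>
  moreover have "d \<noteq> N" using assms(2) by (simp add: N_def)
  ultimately show ?thesis by (simp add: p_def coeff_sum coeff_m)
qed

text \<open>By linearity \<open>g\<close> annihilates every polynomial of degree below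
  \<open>card P\<close>; one that vanishes on \<open>P\<close> except at \<open>s\<close> isolates
  \<open>g s\<close>.\<close>

lemma vandermonde_kernel_trivial:
  fixes P :: "'a::field set"
  assumes "finite P" and "\<And>d. d < card P \<Longrightarrow> (\<Sum>t\<in>P. g t * t ^ d) = 0" and "s \<in> P"
  shows "g s = 0"
proof -
  define m where "m = (\<Prod>q\<in>P - {s}. [:- q, 1:])"
  have deg: "degree m < card P"
    using assms(1,3) card_gt_0_iff[of P] by (auto simp: m_def degree_prod_sum_eq)
  have "(\<Sum>t\<in>P. g t * poly m t) = (\<Sum>t\<in>P. \<Sum>d\<le>degree m. coeff m d * (g t * t ^ d))"
    by (simp add: poly_altdef sum_distrib_left mult_ac)
  also have "\<dots> = (\<Sum>d\<le>degree m. coeff m d * (\<Sum>t\<in>P. g t * t ^ d))"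
    by (subst sum.swap) (simp add: sum_distrib_left)
  also have "\<dots> = 0" using assms(2) deg by simp
  finally have "0 = (\<Sum>t\<in>P. g t * poly m t)" by simp
  also have "\<dots> = (\<Sum>t\<in>P. if t = s then g s * poly m s else 0)"
    using assms(1) by (intro sum.cong) (auto simp: m_def poly_prod)
  also have "\<dots> = g s * poly m s" using assms(1,3) by simp
  finally show ?thesis using assms(1) by (auto simp: m_def poly_prod)
qed

section \<open>Moment vectors in three blocks and their wedge products\<close>

definition block_vec :: "nat \<Rightarrow> nat \<Rightarrow> 'a::field \<Rightarrow> nat \<Rightarrow> 'a" where
  "block_vec k s t = (\<lambda>i. if i div k = s then t ^ (i mod k) else 0)"

lemma block_vec_in_Kn: "k > 0 \<Longrightarrow> s < 3 \<Longrightarrow> block_vec k s t \<in> Kn (3 * k)"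
  by (auto simp: Kn_def block_vec_def div_less_iff_less_mult)

lemma fscale_in_Kn: "x \<in> Kn n \<Longrightarrow> fscale c x \<in> Kn n"
  by (auto simp: Kn_def fscale_def)

abbreviation block_wedge :: "nat \<Rightarrow> 'a::field \<Rightarrow> nat \<times> nat \<times> nat \<Rightarrow> 'a" where
  "block_wedge k t \<equiv> wedge3 (block_vec k 0 t) (block_vec k 1 t) (block_vec k 2 t)"

text \<open>The exponent in \<open>block_vec\<close> depends only on the coordinate index, so all
  six terms of the alternating sum carry the same power of \<open>t\<close>; the value at
  \<open>1\<close> is the coefficient.\<close>

lemma block_wedge_eq_monomial:
  "block_wedge k t (i, j, l) = block_wedge k 1 (i, j, l) * t ^ (i mod k + j mod k + l mod k)"
  by (simp add: wedge3_apply block_vec_def power_add)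

lemma block_wedge_weighted_sum:
  fixes P :: "'a::field set"
  assumes "finite P" "k > 0" "3 * k \<le> card P + 1"
  shows "(\<Sum>t\<in>P. fscale (lagrange_weight P t) (block_wedge k t)) = 0"
proof -
  have "(\<Sum>t\<in>P. fscale (lagrange_weight P t) (block_wedge k t)) (i, j, l) = 0" for i j l
  proof -
    \<comment> \<open>Each residue is at most \<open>k - 1\<close>, so the left side is at most
      \<open>3 * k - 1\<close>.\<close>
    have "i mod k + j mod k + l mod k + 2 \<le> card P"
      using assms mod_less_divisor[of k i] mod_less_divisor[of k j] mod_less_divisor[of k l]
      by linarith
    note moment = sum_lagrange_weight_power[OF assms(1) this]
    have "(\<Sum>t\<in>P. fscale (lagrange_weight P t) (block_wedge k t)) (i, j, l)
        = (\<Sum>t\<in>P. block_wedge k 1 (i, j, l)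
            * (lagrange_weight P t * t ^ (i mod k + j mod k + l mod k)))"
      unfolding sum_apply fscale_def
      by (subst block_wedge_eq_monomial) (simp only: mult.left_commute)
    also have "\<dots> = 0" unfolding sum_distrib_left[symmetric] moment by simp
    finally show ?thesis .
  qed
  then show ?thesis by (auto simp: fun_eq_iff)
qed

text \<open>These two coordinates recover \<open>c\<close> and \<open>c * t\<close>, so a nonzero
  multiple determines its point. For \<open>k \<ge> 2\<close>, index \<open>1\<close> still lies in
  the first block.\<close>

lemma fscale_block_wedge_nth:
  assumes "k \<ge> 2"
  shows "fscale c (block_wedge k t) (0, k, 2 * k) = c / 6"
    and "fscale c (block_wedge k t) (1, k, 2 * k) = c * t / 6"
  using assms by (auto simp: fscale_def wedge3_apply block_vec_def)

section \<open>Linear independence and the Kruskal rank\<close>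

text \<open>The weight on the first block is carried by the vectors, since the terms of an expression
  have no separate coefficients.\<close>
lemma independent_block_family:
  fixes t w :: "nat \<Rightarrow> 'a::field" and k :: nat
  defines "F \<equiv> \<lambda>(i, s). if s = 0 then fscale (w i) (block_vec k s (t i)) else block_vec k s (t i)"
  assumes "finite I" "card I = k" "inj_on t I" "\<And>i. i \<in> I \<Longrightarrow> w i \<noteq> 0"
  shows "inj_on F (I \<times> {..<3})" and "fsp.independent (F ` (I \<times> {..<3}))"
proof -
  define w' where "w' i s = (if s = 0 then w i else 1)" for i and s :: nat
  have F: "F (i, s) = fscale (w' i s) (block_vec k s (t i))" for i s
    by (auto simp: F_def w'_def fscale_def)
  have w': "w' i s \<noteq> 0" if "i \<in> I" for i s using that assms by (simp add: w'_def)
  have coeff0: "g (i, s) = 0"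
    if sum0: "(\<Sum>p\<in>I \<times> {..<3}. fscale (g p) (F p)) = 0" and "i \<in> I" "s < 3" for g i s
  proof -
    have "(\<Sum>i\<in>I. g (i, s) * w' i s * t i ^ d) = 0" if "d < k" for d
    proof -
      \<comment> \<open>Coordinate \<open>s * k + d\<close> sees only block \<open>s\<close>, with
        exponent \<open>d\<close>: it reads off the \<open>d\<close>-th moment of that
        block.\<close>
      have "0 = (\<Sum>p\<in>I \<times> {..<3}. fscale (g p) (F p)) (s * k + d)" by (simp add: sum0)
      also have "\<dots> = (\<Sum>i\<in>I. \<Sum>s'<3. if s' = s then g (i, s) * w' i s * t i ^ d else 0)"
        unfolding sum_apply sum.cartesian_product
        using that by (intro sum.cong) (auto simp: F fscale_def block_vec_def)
      also have "\<dots> = (\<Sum>i\<in>I. g (i, s) * w' i s * t i ^ d)" using \<open>s < 3\<close> by simp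
      finally show ?thesis by simp
    qed
    \<comment> \<open>The Vandermonde argument sums over points, so coefficients are carried from
      indices to points.\<close>
    then have "(\<Sum>x\<in>t ` I. (\<lambda>x. g (inv_into I t x, s) * w' (inv_into I t x) s) x * x ^ d) = 0"
      if "d < card (t ` I)" for d
      using that assms by (simp add: sum.reindex card_image)
    from vandermonde_kernel_trivial[OF _ this, of "t i"] show ?thesis
      using assms \<open>i \<in> I\<close> w'[of i s] by simp
  qed
  show inj: "inj_on F (I \<times> {..<3})"
  proof (rule inj_onI)
    fix p q assume pq: "p \<in> I \<times> {..<3}" "q \<in> I \<times> {..<3}" "F p = F q"
    show "p = q"
    proof (rule ccontr)
      assume "p \<noteq> q"
      define g :: "nat \<times> nat \<Rightarrow> 'a" where "g = (\<lambda>x. if x = p then 1 else if x = q then -1 else 0)"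
      have "(\<Sum>x\<in>I \<times> {..<3}. fscale (g x) (F x)) = (\<Sum>x\<in>{p, q}. fscale (g x) (F x))"
        using assms(2) pq by (intro sum.mono_neutral_right) (auto simp: g_def)
      also have "\<dots> = 0" using \<open>p \<noteq> q\<close> pq(3) by (simp add: g_def)
      finally have "g p = 0" using coeff0[of g "fst p" "snd p"] pq(1) by auto
      then show False by (simp add: g_def)
    qed
  qed
  show "fsp.independent (F ` (I \<times> {..<3}))"
  proof (rule fsp.independent_if_scalars_zero)
    fix f x
    assume "(\<Sum>x\<in>F ` (I \<times> {..<3}). fscale (f x) x) = 0" and x: "x \<in> F ` (I \<times> {..<3})"
    then have "(\<Sum>p\<in>I \<times> {..<3}. fscale ((f \<circ> F) p) (F p)) = 0"
      by (simp add: sum.reindex[OF inj])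
    from coeff0[OF this] x show "f x = 0" by auto
  qed (use assms in auto)
qed

text \<open>Both sides equal \<open>card I * card J\<close>, as subfamilies of an independent family
  are independent.\<close>

lemma (in vector_space) dim_span_Union_independent_family:
  assumes "finite I" "finite J" "inj_on f (I \<times> J)" "independent (f ` (I \<times> J))"
  shows "dim (span (\<Union>i\<in>I. span (f ` ({i} \<times> J)))) = (\<Sum>i\<in>I. dim (span (f ` ({i} \<times> J))))"
proof -
  have "span (\<Union>i\<in>I. span (f ` ({i} \<times> J))) = span (f ` (I \<times> J))"
  proof (rule subset_antisym)
    show "span (\<Union>i\<in>I. span (f ` ({i} \<times> J))) \<subseteq> span (f ` (I \<times> J))"
      by (intro span_minimal UN_least span_mono subspace_span) auto
    show "span (f ` (I \<times> J)) \<subseteq> span (\<Union>i\<in>I. span (f ` ({i} \<times> J)))"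
      by (intro span_mono) (auto intro: span_base)
  qed
  then have "dim (span (\<Union>i\<in>I. span (f ` ({i} \<times> J)))) = card I * card J"
    using assms by (simp add: dim_span_eq_card_independent card_image card_cartesian_product del: dim_span)
  moreover have "dim (span (f ` ({i} \<times> J))) = card J" if "i \<in> I" for i
  proof -
    have sub: "{i} \<times> J \<subseteq> I \<times> J" using that by auto
    have "independent (f ` ({i} \<times> J))"
      by (rule independent_mono[OF assms(4) image_mono[OF sub]])
    then show ?thesis
      using inj_on_subset[OF assms(3) sub]
      by (simp add: dim_span_eq_card_independent card_image card_cartesian_product del: dim_span)
  qed
  ultimately show ?thesis by simp
qed

text \<open>Any \<open>k\<close> indices give distinct points, hence \<open>3 * k\<close>
  independent vectors; so \<open>k\<close> is among the sizes whose maximum is taken.\<close>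

lemma kruskal_rank_block_family:
  fixes t w :: "nat \<Rightarrow> 'a::field"
  assumes "k \<le> r" "inj_on t {..<r}" "\<And>i. i < r \<Longrightarrow> w i \<noteq> 0"
  shows "kruskal_rank r (\<lambda>i. fsp.span
           {fscale (w i) (block_vec k 0 (t i)), block_vec k 1 (t i), block_vec k 2 (t i)}) \<ge> k"
proof -
  define F where "F = (\<lambda>(i, s). if s = (0::nat) then fscale (w i) (block_vec k s (t i))
                                else block_vec k s (t i))"
  have three: "{..<3::nat} = {0, 1, 2}" by auto
  have U: "(\<lambda>i. fsp.span {fscale (w i) (block_vec k 0 (t i)), block_vec k 1 (t i), block_vec k 2 (t i)})
      = (\<lambda>i. fsp.span (F ` ({i} \<times> {..<3})))"
    by (auto simp: F_def three)
  have "in_direct_sum I (\<lambda>i. fsp.span (F ` ({i} \<times> {..<3})))"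
    if "I \<subseteq> {..<r}" "card I = k" for I
  proof -
    have "finite I" using that(1) finite_subset by blast
    moreover have "inj_on t I" using assms(2) that(1) inj_on_subset by blast
    moreover have "w i \<noteq> 0" if "i \<in> I" for i using that \<open>I \<subseteq> {..<r}\<close> assms(3) by auto
    ultimately show ?thesis
      unfolding in_direct_sum_def F_def using that(2)
      by (intro fsp.dim_span_Union_independent_family independent_block_family) auto
  qed
  then show ?thesis
    unfolding kruskal_rank_def U using assms(1) by (intro Max_ge) auto
qed

section \<open>Two expressions of one tensor\<close>

theorem theorem5p3:
  fixes r k :: nat
  assumes "r > 0" and "k > 0" and "k \<noteq> 1"
    and "CHAR('a::field) = 0 \<or> CHAR('a) \<ge> 5"
    and "(infinite (UNIV :: 'a set) \<or> card (UNIV :: 'a set) > 2 * r)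
         \<or> (finite (UNIV :: 'a set) \<and> CHAR('a) \<ge> 2 * r)"
    and "2 * r = 3 * k - 1"
  shows "\<exists>n (T :: nat \<times> nat \<times> nat \<Rightarrow> 'a) a b c.
           T \<in> Lambda3 n \<and>
           (\<forall>i<r. a i \<in> Kn n \<and> b i \<in> Kn n \<and> c i \<in> Kn n) \<and>
           T = (\<Sum>i<r. wedge3 (a i) (b i) (c i)) \<and>
           (\<forall>i<r. wedge3 (a i) (b i) (c i) \<noteq> 0) \<and>
           kruskal_rank r (\<lambda>i. fsp.span {a i, b i, c i}) \<ge> k \<and>
           \<not> unique_skew_rank_decomposition n r a b c T"
proof -
  \<comment> \<open>For \<open>k = 1\<close> the equation would force \<open>r = 1\<close>, where a
    nonzero term is always unique.\<close>
  have "k \<ge> 2" "k \<le> r" using assms by auto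
  have six: "(6::'a) \<noteq> 0"
  proof -
    have "\<not> CHAR('a) dvd 2" "\<not> CHAR('a) dvd 3" using assms(4) by (auto dest: dvd_imp_le)
    then have "(2::'a) \<noteq> 0" "(3::'a) \<noteq> 0"
      using of_nat_eq_0_iff_char_dvd[of 2, where 'a='a] of_nat_eq_0_iff_char_dvd[of 3, where 'a='a]
      by auto
    then have "(2::'a) * 3 \<noteq> 0" by (simp only: mult_eq_0_iff) simp
    then show ?thesis by simp
  qed
  obtain P :: "'a set" where P: "finite P" "card P = 2 * r"
  proof (cases "finite (UNIV :: 'a set)")
    case True
    \<comment> \<open>The multiples of one below the characteristic are distinct, so either size
      condition provides \<open>2 * r\<close> points.\<close>
    have "CHAR('a) \<le> card (UNIV :: 'a set)"
    proof -
      have "of_nat x \<noteq> (of_nat y :: 'a)" if "x < y" "y < CHAR('a)" for x y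
      proof
        assume "of_nat x = (of_nat y :: 'a)"
        then have "of_nat (y - x) = (0 :: 'a)" using that by (simp add: of_nat_diff)
        then have "CHAR('a) dvd y - x" by (simp add: of_nat_eq_0_iff_char_dvd)
        then show False using that by (auto dest: dvd_imp_le)
      qed
      then have "inj_on (of_nat :: nat \<Rightarrow> 'a) {..<CHAR('a)}"
        by (intro linorder_inj_onI) auto
      then have "card {..<CHAR('a)} \<le> card (UNIV :: 'a set)"
        using True by (intro card_inj_on_le) auto
      then show ?thesis by simp
    qed
    then have "2 * r \<le> card (UNIV :: 'a set)" using assms(5) True by auto
    then show ?thesis using that obtain_subset_with_card_n by metis
  next
    case False
    then show ?thesis using that infinite_arbitrarily_large by metis
  qed
  obtain t where t: "bij_betw t {..<2 * r} P"
    using ex_bij_betw_nat_finite[OF P(1)] P(2) by (auto simp: atLeast0LessThan)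
  define w where "w i = lagrange_weight P (t i)" for i
  define a where "a i = fscale (w i) (block_vec k 0 (t i))" for i
  define b where "b i = block_vec k 1 (t i)" for i
  define c where "c i = block_vec k 2 (t i)" for i
  \<comment> \<open>The sign moves the second half of the vanishing sum to the other side.\<close>
  define a' where "a' i = fscale (- w (r + i)) (block_vec k 0 (t (r + i)))" for i
  define b' where "b' i = b (r + i)" for i
  define c' where "c' i = c (r + i)" for i
  define T where "T = (\<Sum>i<r. wedge3 (a i) (b i) (c i))"
  have w: "w i \<noteq> 0" for i by (simp add: w_def lagrange_weight_nonzero P)
  have inj: "inj_on t {..<2 * r}" using t by (rule bij_betw_imp_inj_on)
  have wedge_abc: "wedge3 (a i) (b i) (c i) = fscale (w i) (block_wedge k (t i))" for i
    by (simp add: a_def b_def c_def wedge3_fscale)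
  have wedge_abc': "wedge3 (a' i) (b' i) (c' i) = fscale (- w (r + i)) (block_wedge k (t (r + i)))" for i
    unfolding a'_def b'_def c'_def b_def c_def by (rule wedge3_fscale)
  have Kn: "a i \<in> Kn (3 * k)" "b i \<in> Kn (3 * k)" "c i \<in> Kn (3 * k)"
    "a' i \<in> Kn (3 * k)" "b' i \<in> Kn (3 * k)" "c' i \<in> Kn (3 * k)" for i
    unfolding a_def b_def c_def a'_def b'_def c'_def
    by (intro fscale_in_Kn block_vec_in_Kn assms(2); simp)+
  have "T \<in> Lambda3 (3 * k)"
    unfolding T_def Lambda3_def using Kn by (intro fsp.span_sum fsp.span_base) blast
  moreover have "wedge3 (a i) (b i) (c i) \<noteq> 0" for i
    using fscale_block_wedge_nth(1)[OF \<open>k \<ge> 2\<close>, of "w i" "t i"] w[of i] six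
    by (metis divide_eq_0_iff wedge_abc zero_fun_apply)
  moreover have "kruskal_rank r (\<lambda>i. fsp.span {a i, b i, c i}) \<ge> k"
    unfolding a_def b_def c_def using w \<open>k \<le> r\<close> inj
    by (intro kruskal_rank_block_family) (auto intro: inj_on_subset)
  moreover have "\<not> unique_skew_rank_decomposition (3 * k) r a b c T"
  proof
    assume uniq: "unique_skew_rank_decomposition (3 * k) r a b c T"
    have "T = (\<Sum>i<r. wedge3 (a' i) (b' i) (c' i))"
    proof -
      \<comment> \<open>Here \<open>card P + 1 = 3 * k\<close>, so the degree bound holds with
        equality.\<close>
      have "0 = (\<Sum>x\<in>P. fscale (lagrange_weight P x) (block_wedge k x))"
        using block_wedge_weighted_sum[OF P(1) assms(2)] assms(6) P(2) by simp
      also have "\<dots> = (\<Sum>i<2 * r. wedge3 (a i) (b i) (c i))"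
        unfolding wedge_abc w_def by (rule sum.reindex_bij_betw[OF t, symmetric])
      also have "\<dots> = T + (\<Sum>i<r. wedge3 (a (r + i)) (b (r + i)) (c (r + i)))"
      proof -
        have "sum f {..<m + n} = sum f {..<m} + (\<Sum>i<n. f (m + i))"
          for f :: "nat \<Rightarrow> nat \<times> nat \<times> nat \<Rightarrow> 'a" and m n
          by (induction n) (simp_all add: add.assoc)
        then show ?thesis by (simp add: T_def mult_2)
      qed
      also have "\<dots> = T - (\<Sum>i<r. wedge3 (a' i) (b' i) (c' i))"
        unfolding wedge_abc wedge_abc' by (simp add: fsp.scale_minus_left sum_negf)
      finally show ?thesis by simp
    qed
    then have "skew_expression (3 * k) r a' b' c' T"
      using Kn by (simp add: skew_expression_def)
    then obtain \<pi> where \<pi>: "\<pi> permutes {..<r}"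
      and eq: "\<forall>i<r. wedge3 (a' i) (b' i) (c' i) = wedge3 (a (\<pi> i)) (b (\<pi> i)) (c (\<pi> i))"
      using uniq unfolding unique_skew_rank_decomposition_def by blast
    \<comment> \<open>One matched pair suffices: it forces the points \<open>t r\<close> and
      \<open>t j\<close> to agree although \<open>j < r\<close>.\<close>
    define j where "j = \<pi> 0"
    have "j < r" using permutes_in_image[OF \<pi>, of 0] assms(1) by (simp add: j_def)
    have "fscale (- w r) (block_wedge k (t r)) = fscale (w j) (block_wedge k (t j))"
      using eq assms(1) unfolding wedge_abc wedge_abc' j_def by fastforce
    from fun_cong[OF this, of "(0, k, 2 * k)"] fun_cong[OF this, of "(1, k, 2 * k)"]
    have "- w r = w j" "- w r * t r = w j * t j"
      unfolding fscale_block_wedge_nth[OF \<open>k \<ge> 2\<close>] using six by simp_all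
    then have "t r = t j" using w[of j] by auto
    then show False using inj \<open>j < r\<close> by (auto dest: inj_onD)
  qed
  ultimately show ?thesis
    using Kn by (intro exI[of _ "3 * k"] exI[of _ T] exI[of _ a] exI[of _ b] exI[of _ c]) (simp add: T_def)
qed

end
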